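(* Let $n^{(1)}=n^{(L)}=d$, let $T>0$, and suppose that the activation functions $g^{(\ell)}:\mathbb{R}\to\mathbb{R}$, $\ell=2,\dots,L$, of the feed-forward artificial neural network are globally Lipschitz. Then for every parameter vector $u\in\mathbb{R}^K$ and all initial values $z_0^1,\dots,z_0^N\in\mathbb{R}^d$ there exists a unique solution $x=(x_1,\dots,x_N)\in C^1([0,T],\mathbb{R}^{dN})$ of $$\frac{d}{dt}x_i=\sum_{j=1}^N W_u^{i,j}(x_j-x_i),\qquad x_i(0)=z_0^i,\qquad i=1,\dots,N.$$
   Context: Feed-forward artificial neural network (NN): fix an integer $L\ge 2$, layer sizes $n^{(1)},\dots,n^{(L)}\in\mathbb{N}$, activation functions $g^{(\ell)}:\mathbb{R}\to\mathbb{R}$ for $\ell=2,\dots,L$, and weights $u^{(\ell)}_{j,k}\in\mathbb{R}$ for $\ell=1,\dots,L-1$. For an input $\xi\in\mathbb{R}^{n^{(1)}}$ put - input layer: $a_1^{(1)}=1$, $a_k^{(1)}=\xi_{k-1}$ for $k\in\{2,\dots,n^{(1)}+1\}$; - hidden layers: $a_1^{(\ell)}=1$, $a_k^{(\ell)}=g^{(\ell)}\big(\sum_{j=1}^{n^{(\ell-1)}+1}u^{(\ell-1)}_{j,k}a_j^{(\ell-1)}\big)$ for $\ell\in\{2,\dots,L-1\}$, $k\in\{2,\dots,n^{(\ell)}+1\}$; - output layer: $a_k^{(L)}=g^{(L)}\big(\sum_{j=1}^{n^{(L-1)}+1}u^{(L-1)}_{j,k}a_j^{(L-1)}\big)$ for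 $k\in\{1,\dots,n^{(L)}\}$. All weights are collected in one vector $u\in\mathbb{R}^K$, where $K$ is the total number of weights. With $n^{(1)}=n^{(L)}=d$, the network defines a map $W_u:\mathbb{R}^d\to\mathbb{R}^d$, $\xi\mapsto(a_1^{(L)},\dots,a_d^{(L)})$. Interaction terms: there are $N$ agents in $\mathbb{R}^d$. All agents are driven by the same network; the indices $i,j$ only record which pairs interact. For each pair $(i,j)$, $W_u^{i,j}:\mathbb{R}^d\to\mathbb{R}^d$ is either $W_u$, or identically zero, or the output map $W_{\hat u}$ of the feed-forward network with the same layer sizes $n^{(1)},\dots,n^{(L)}$ and the same activation functions $g^{(2)},\dots,g^{(L)}$, but with a fixed weight vector $\hat u\in\mathbb{R}^K$ (possibly depending on $(i,j)$) that does not depend on $u$. *)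

theory Defs
  imports "HOL-Analysis.Analysis"
begin

text \<open>
  A network is given by its depth \<open>L\<close>, layer sizes \<open>n l\<close> (\<open>1 \<le> l \<le> L\<close>, bias nodes not counted)
  and activation functions \<open>g l\<close> (\<open>2 \<le> l \<le> L\<close>). Layers and nodes are numbered from 1.
  Every layer but the last contains a bias node, which is node 1 of that layer.

  The triple \<open>(l, j, k)\<close> indexes the weight from node \<open>j\<close> of layer \<open>l\<close> to node \<open>k\<close> of
  layer \<open>l + 1\<close>; no weight leads into a bias node.
\<close>

definition weight_index :: "nat \<Rightarrow> (nat \<Rightarrow> nat) \<Rightarrow> (nat \<times> nat \<times> nat) set" where
  "weight_index L n =
    {(l, j, k). l \<in> {1..L - 1} \<and> j \<in> {1..n l + 1} \<and>
                k \<in> (if l + 1 < L then {2..n (l + 1) + 1} else {1..n L})}"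

text \<open>The space $\mathbb{R}^K$ with $K$ the cardinality of the weight index set.\<close>

definition weight_vectors :: "nat \<Rightarrow> (nat \<Rightarrow> nat) \<Rightarrow> (nat \<times> nat \<times> nat \<Rightarrow> real) set" where
  "weight_vectors L n = weight_index L n \<rightarrow>\<^sub>E UNIV"

text \<open>
  Value of node \<open>k\<close> in layer \<open>l\<close>. The map \<open>e\<close> numbers the coordinates of the input space:
  \<open>\<xi> $ e k\<close> is the \<open>k\<close>-th coordinate of \<open>\<xi>\<close>. There is no layer 0; its value is a dummy.
\<close>

fun node_value ::
  "nat \<Rightarrow> (nat \<Rightarrow> nat) \<Rightarrow> (nat \<Rightarrow> real \<Rightarrow> real) \<Rightarrow> (nat \<Rightarrow> 'd) \<Rightarrow>
   (nat \<times> nat \<times> nat \<Rightarrow> real) \<Rightarrow> real ^ 'd \<Rightarrow> nat \<Rightarrow> nat \<Rightarrow> real" where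
  "node_value L n g e u \<xi> 0 k = 0"
| "node_value L n g e u \<xi> (Suc 0) k = (if k = 1 then 1 else \<xi> $ e (k - 1))"
| "node_value L n g e u \<xi> (Suc (Suc m)) k =
    (if Suc (Suc m) < L \<and> k = 1 then 1
     else g (Suc (Suc m))
            (\<Sum>j = 1..n (Suc m) + 1. u (Suc m, j, k) * node_value L n g e u \<xi> (Suc m) j))"

text \<open>
  The input-output map; the coordinates of the output space are numbered by the same \<open>e\<close>, which is
  meant to be a bijection from \<open>{1..n L}\<close> onto the index type.
\<close>

definition network_map ::
  "nat \<Rightarrow> (nat \<Rightarrow> nat) \<Rightarrow> (nat \<Rightarrow> real \<Rightarrow> real) \<Rightarrow> (nat \<Rightarrow> 'd) \<Rightarrow>
   (nat \<times> nat \<times> nat \<Rightarrow> real) \<Rightarrow> real ^ 'd \<Rightarrow> real ^ 'd" where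
  "network_map L n g e u \<xi> = (\<chi> c. node_value L n g e u \<xi> L (inv_into {1..n L} e c))"

text \<open>
  Which of the three alternatives holds for a pair \<open>(i, j)\<close>, and the frozen weights \<open>v\<close> in the
  third one, are chosen once for all \<open>u\<close>.
\<close>

definition interaction_terms ::
  "nat \<Rightarrow> (nat \<Rightarrow> nat) \<Rightarrow> (nat \<Rightarrow> real \<Rightarrow> real) \<Rightarrow> (nat \<Rightarrow> 'd) \<Rightarrow>
   ((nat \<times> nat \<times> nat \<Rightarrow> real) \<Rightarrow> 'n \<Rightarrow> 'n \<Rightarrow> real ^ 'd \<Rightarrow> real ^ 'd) \<Rightarrow> bool" where
  "interaction_terms L n g e W \<longleftrightarrow>
    (\<forall>i j.
      (\<forall>u\<in>weight_vectors L n. W u i j = network_map L n g e u) \<or>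
      (\<forall>u\<in>weight_vectors L n. W u i j = (\<lambda>_. 0)) \<or>
      (\<exists>v\<in>weight_vectors L n. \<forall>u\<in>weight_vectors L n. W u i j = network_map L n g e v))"

text \<open>
  The library's \<open>C1_differentiable_on\<close> asks for two-sided derivatives at the end points;
  here they are one-sided.
\<close>

definition C1_on_interval :: "real \<Rightarrow> (real \<Rightarrow> 'a::real_normed_vector) \<Rightarrow> bool" where
  "C1_on_interval T x \<longleftrightarrow>
    (\<exists>x'. (\<forall>t\<in>{0..T}. (x has_vector_derivative x' t) (at t within {0..T})) \<and>
          continuous_on {0..T} x')"

definition agent_solution ::
  "real \<Rightarrow> ('n \<Rightarrow> 'n \<Rightarrow> real ^ 'd \<Rightarrow> real ^ 'd) \<Rightarrow> real ^ 'd ^ 'n \<Rightarrow>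
   (real \<Rightarrow> real ^ 'd ^ 'n) \<Rightarrow> bool" where
  "agent_solution T V z0 x \<longleftrightarrow>
    C1_on_interval T x \<and>
    (\<forall>i. \<forall>t\<in>{0..T}.
      ((\<lambda>s. x s $ i) has_vector_derivative (\<Sum>j\<in>UNIV. V i j (x t $ j - x t $ i)))
        (at t within {0..T})) \<and>
    (\<forall>i. x 0 $ i = z0 $ i)"

end

(*
  Every node of the network is a globally Lipschitz function of the input, so the right-hand side
  of the system is a globally Lipschitz vector field F. In the variable exp (- 2 K t) x(t), with K
  a positive Lipschitz constant of F, the Picard operator contracts the space of continuous
  functions on all of [0, T] by the factor 1/2. Hence Banach's theorem gives the solution on the
  whole interval at once, together with its uniqueness.
*)
theory Submission
  imports Defs
begin

section \<open>Global existence and uniqueness for Lipschitz vector fields\<close>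

lemma global_picard_lindelof:
  fixes F :: "'a::banach \<Rightarrow> 'a"
  assumes F: "C-lipschitz_on UNIV F" and T: "T \<ge> 0"
  obtains x where "x 0 = x0"
    and "\<And>t. t \<in> {0..T} \<Longrightarrow> (x has_vector_derivative F (x t)) (at t within {0..T})"
    and "\<And>y t. \<lbrakk>y 0 = x0;
           \<And>t. t \<in> {0..T} \<Longrightarrow> (y has_vector_derivative F (y t)) (at t within {0..T});
           t \<in> {0..T}\<rbrakk> \<Longrightarrow> y t = x t"
proof -
  \<comment> \<open>Adding 1 keeps \<open>K\<close> a Lipschitz constant of \<open>F\<close> and
    makes it positive even for \<open>C = 0\<close>.\<close>
  define K where "K = C + 1"
  have "C \<ge> 0" using F by (rule lipschitz_on_nonneg)
  then have K0: "K > 0" by (simp add: K_def)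
  have K: "norm (F a - F b) \<le> K * norm (a - b)" for a b
    using lipschitz_onD[OF F, of a b] mult_right_mono[of C K "norm (a - b)"]
    by (simp add: K_def dist_norm)
  have contF: "continuous_on S (\<lambda>r. F (z r))" if "continuous_on S z" for S and z :: "real \<Rightarrow> 'a"
    using continuous_on_compose2[OF lipschitz_on_continuous_on[OF F] that] by simp
  \<comment> \<open>The function \<open>f\<close> stands for a trajectory damped by
    \<open>exp (- 2 * K * r)\<close>, and \<open>u f\<close> is the trajectory itself. The sup
    distance of such \<open>f\<close> is thus a weighted (Bielecki) distance of
    trajectories.\<close>
  define u where "u f r = exp (2 * K * r) *\<^sub>R apply_bcontfun f r" for f :: "real \<Rightarrow>\<^sub>C 'a" and r
  have contu: "continuous_on S (u f)" for S f
    unfolding u_def by (intro continuous_intros) auto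
  have intF: "(\<lambda>r. F (u f r)) integrable_on {0..t}" for f t
    by (intro integrable_continuous_real contF contu)
  define \<Phi> where "\<Phi> f t = exp (- 2 * K * t) *\<^sub>R (x0 + integral {0..t} (\<lambda>r. F (u f r)))" for f t
  \<comment> \<open>Elements of the complete space used here are defined on all reals, so
    \<open>clamp\<close> extends \<open>\<Phi> f\<close> from \<open>{0..T}\<close> by its end
    values.\<close>
  have "\<exists>h. \<forall>t. apply_bcontfun h t = \<Phi> f (clamp 0 T t)" for f
  proof -
    have "continuous_on {0..T} (\<Phi> f)"
      unfolding \<Phi>_def by (intro continuous_intros indefinite_integral_continuous_1 intF)
    then obtain h :: "real \<Rightarrow>\<^sub>C 'a" where "\<And>t. apply_bcontfun h t = \<Phi> f (clamp 0 T t)"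
      using continuous_on_cbox_bcontfunE[of 0 T "\<Phi> f"] by auto
    then show ?thesis by blast
  qed
  then obtain P :: "(real \<Rightarrow>\<^sub>C 'a) \<Rightarrow> (real \<Rightarrow>\<^sub>C 'a)"
    where P: "\<And>f t. apply_bcontfun (P f) t = \<Phi> f (clamp 0 T t)"
    by metis
  have \<Phi>_dist: "dist (\<Phi> f t) (\<Phi> h t) \<le> 1/2 * dist f h" if t: "t \<in> {0..T}" for f h t
  proof -
    define D where "D = dist f h"
    \<comment> \<open>The factor 2 in the exponent becomes the 1/2 in the antiderivative; this is
      the source of the contraction constant.\<close>
    have *: "((\<lambda>r. K * exp (2 * K * r) * D) has_integral
               exp (2 * K * t) / 2 * D - exp (2 * K * 0) / 2 * D) {0..t}"
      using t by (intro fundamental_theorem_of_calculus)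
        (auto simp flip: has_real_derivative_iff_has_vector_derivative intro!: derivative_eq_intros)
    have "norm (integral {0..t} (\<lambda>r. F (u f r)) - integral {0..t} (\<lambda>r. F (u h r)))
        = norm (integral {0..t} (\<lambda>r. F (u f r) - F (u h r)))"
      by (simp add: integral_diff intF)
    also have "\<dots> \<le> integral {0..t} (\<lambda>r. K * exp (2 * K * r) * D)"
    proof (rule integral_norm_bound_integral)
      fix r
      have "norm (F (u f r) - F (u h r)) \<le> K * norm (u f r - u h r)" by (rule K)
      also have "norm (u f r - u h r) = exp (2 * K * r) * dist (apply_bcontfun f r) (apply_bcontfun h r)"
        by (simp add: u_def dist_norm flip: scaleR_diff_right)
      also have "K * \<dots> \<le> K * (exp (2 * K * r) * D)"
        using K0 by (intro mult_left_mono) (auto simp: D_def dist_bounded)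
      finally show "norm (F (u f r) - F (u h r)) \<le> K * exp (2 * K * r) * D" by (simp add: mult.assoc)
    qed (use * in \<open>auto intro!: integrable_diff intF simp: integrable_on_def\<close>)
    also have "\<dots> = exp (2 * K * t) / 2 * D - D / 2"
      by (subst integral_unique[OF *]) simp
    also have "\<dots> \<le> exp (2 * K * t) / 2 * D"
      by (simp add: D_def)
    \<comment> \<open>The damping in \<open>\<Phi>\<close> cancels the growth of the integral, so
      the bound depends on neither \<open>t\<close> nor \<open>T\<close>.\<close>
    finally have "exp (- 2 * K * t) *
        norm (integral {0..t} (\<lambda>r. F (u f r)) - integral {0..t} (\<lambda>r. F (u h r)))
      \<le> exp (- 2 * K * t) * (exp (2 * K * t) / 2 * D)"
      by (intro mult_left_mono) auto
    also have "\<dots> = 1/2 * D" by (simp add: exp_minus)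
    finally show ?thesis
      by (simp add: \<Phi>_def dist_norm D_def flip: scaleR_diff_right)
  qed
  have "\<exists>!f. P f = f"
  proof (rule banach_fix_type)
    \<comment> \<open>Every value of \<open>P f\<close> is a value of \<open>\<Phi> f\<close> on
      \<open>{0..T}\<close>, so the pointwise estimate there controls the sup distance.\<close>
    have "clamp 0 T t \<in> {0..T}" for t :: real
      using clamp_in_interval[of 0 T t] T by simp
    then show "\<forall>f h. dist (P f) (P h) \<le> 1/2 * dist f h"
      by (auto intro!: dist_bound \<Phi>_dist simp only: P)
  qed auto
  then obtain f where f: "P f = f" and f_unique: "\<And>h. P h = h \<Longrightarrow> h = f" by blast
  have clamp: "clamp 0 T t = t" if "t \<in> {0..T}" for t
    using that by simp
  show thesis
  proof
    let ?x = "\<lambda>t. x0 + integral {0..t} (\<lambda>r. F (u f r))"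
    \<comment> \<open>Multiplying the fixed point equation by \<open>exp (2 * K * t)\<close> gives
      the integral form of the differential equation.\<close>
    have *: "u f t = ?x t" if "t \<in> {0..T}" for t
      using P[of f t] by (simp add: f clamp[OF that] u_def \<Phi>_def flip: exp_add)
    show "u f 0 = x0" using *[of 0] T by simp
    show "(u f has_vector_derivative F (u f t)) (at t within {0..T})" if t: "t \<in> {0..T}" for t
    proof (rule has_vector_derivative_transform[OF t])
      show "(?x has_vector_derivative F (u f t)) (at t within {0..T})"
        using t by (auto intro!: derivative_eq_intros integral_has_vector_derivative contF contu)
    qed (rule *)
    fix y t
    assume y0: "y 0 = x0" and t: "t \<in> {0..T}"
      and y: "\<And>t. t \<in> {0..T} \<Longrightarrow> (y has_vector_derivative F (y t)) (at t within {0..T})"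
    \<comment> \<open>For uniqueness, the competitor \<open>y\<close> is damped and extended by its
      end values; the resulting \<open>h\<close> is shown to be a fixed point of
      \<open>P\<close>.\<close>
    have "continuous_on {0..T} y"
      using y has_vector_derivative_continuous continuous_on_eq_continuous_within by blast
    then have "continuous_on {0..T} (\<lambda>t. exp (- 2 * K * t) *\<^sub>R y t)"
      by (intro continuous_intros)
    then obtain h :: "real \<Rightarrow>\<^sub>C 'a"
      where h: "\<And>t. t \<in> {0..T} \<Longrightarrow> apply_bcontfun h t = exp (- 2 * K * t) *\<^sub>R y t"
        and h': "\<And>t. apply_bcontfun h t = exp (- 2 * K * clamp 0 T t) *\<^sub>R y (clamp 0 T t)"
      using continuous_on_cbox_bcontfunE[of 0 T "\<lambda>t. exp (- 2 * K * t) *\<^sub>R y t"] by auto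
    have uh: "u h t = y t" if "t \<in> {0..T}" for t
      using h[OF that] by (simp add: u_def flip: exp_add)
    have \<Phi>h: "\<Phi> h t = exp (- 2 * K * t) *\<^sub>R y t" if t: "t \<in> {0..T}" for t
    proof -
      have "((\<lambda>r. F (y r)) has_integral y t - y 0) {0..t}"
        using t by (intro fundamental_theorem_of_calculus)
          (auto intro: has_vector_derivative_within_subset[OF y])
      then have "integral {0..t} (\<lambda>r. F (y r)) = y t - x0"
        by (simp add: integral_unique y0)
      moreover have "integral {0..t} (\<lambda>r. F (u h r)) = integral {0..t} (\<lambda>r. F (y r))"
        using t by (intro integral_cong) (simp add: uh)
      ultimately show ?thesis by (simp add: \<Phi>_def)
    qed
    have "P h = h"
    proof (rule bcontfun_eqI)
      fix t :: real
      have "clamp 0 T t \<in> {0..T}"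
        using clamp_in_interval[of 0 T t] T by simp
      then show "apply_bcontfun (P h) t = apply_bcontfun h t"
        by (simp only: P \<Phi>h h')
    qed
    then show "y t = u f t"
      using f_unique uh[OF t] by metis
  qed
qed

section \<open>Lipschitz continuity of sums and vectors\<close>

lemma lipschitz_on_sum:
  fixes f :: "'i \<Rightarrow> 'a::metric_space \<Rightarrow> 'b::real_normed_vector"
  assumes "\<And>i. i \<in> I \<Longrightarrow> \<exists>C. C-lipschitz_on S (f i)"
  shows "\<exists>C. C-lipschitz_on S (\<lambda>x. \<Sum>i\<in>I. f i x)"
  using assms
\<comment> \<open>For an infinite \<open>I\<close> the sum is 0 by convention, hence constant as for
  the empty set.\<close>
proof (induction I rule: infinite_finite_induct)
  case (insert i I)
  then obtain C D where "C-lipschitz_on S (f i)" "D-lipschitz_on S (\<lambda>x. \<Sum>i\<in>I. f i x)"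
    by blast
  then have "(C + D)-lipschitz_on S (\<lambda>x. f i x + (\<Sum>i\<in>I. f i x))"
    by (rule lipschitz_on_add)
  then show ?case
    using insert.hyps by auto
qed (auto intro: lipschitz_on_constant)

text \<open>The Euclidean distance is at most the sum of the coordinate distances, so the sum of the
  coordinate constants serves for \<open>f\<close>.\<close>

lemma lipschitz_on_vec:
  fixes f :: "'a::metric_space \<Rightarrow> 'b::real_normed_vector ^ 'n::finite"
  assumes "\<And>i. \<exists>C. C-lipschitz_on S (\<lambda>x. f x $ i)"
  shows "\<exists>C. C-lipschitz_on S f"
proof -
  obtain C :: "'n \<Rightarrow> real" where C: "\<And>i. (C i)-lipschitz_on S (\<lambda>x. f x $ i)"
    using assms by metis
  have "(\<Sum>i\<in>UNIV. C i)-lipschitz_on S f"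
  proof (rule lipschitz_onI)
    fix x y assume xy: "x \<in> S" "y \<in> S"
    have "dist (f x) (f y) \<le> (\<Sum>i\<in>UNIV. dist (f x $ i) (f y $ i))"
      unfolding dist_vec_def by (rule L2_set_le_sum) simp
    also have "\<dots> \<le> (\<Sum>i\<in>UNIV. C i * dist x y)"
      by (intro sum_mono lipschitz_onD[OF C] xy)
    finally show "dist (f x) (f y) \<le> (\<Sum>i\<in>UNIV. C i) * dist x y"
      by (simp add: sum_distrib_right)
  qed (intro sum_nonneg lipschitz_on_nonneg[OF C])
  then show ?thesis ..
qed

lemma lipschitz_on_vec_nth: "1-lipschitz_on S (\<lambda>x. x $ i)"
  by (rule lipschitz_onI) (auto simp: dist_vec_nth_le)

section \<open>Lipschitz continuity of the network\<close>

text \<open>Induction over layers: bias nodes are constant, input nodes are coordinates, and any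
  other node applies a Lipschitz activation to a linear combination of nodes one layer
  below.\<close>

lemma node_value_lipschitz:
  assumes "\<forall>l\<in>{2..L}. \<exists>C. C-lipschitz_on UNIV (g l)" and "l \<le> L"
  shows "\<exists>C. C-lipschitz_on UNIV (\<lambda>\<xi>. node_value L n g e u \<xi> l k)"
  using assms(2)
proof (induction l arbitrary: k rule: less_induct)
  case (less l)
  consider "l = 0" | "l = 1" | m where "l = Suc (Suc m)"
    by (metis One_nat_def not0_implies_Suc)
  then show ?case
  proof cases
    case 1
    then show ?thesis by (auto intro: lipschitz_on_constant)
  next
    case 2
    then show ?thesis
      by (cases "k = 1") (auto intro: lipschitz_on_constant lipschitz_on_vec_nth)
  next
    case 3
    obtain C where C: "C-lipschitz_on UNIV (g l)"
      using assms(1) less.prems 3 by fastforce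
    have "\<exists>D. D-lipschitz_on UNIV
        (\<lambda>\<xi>. \<Sum>j = 1..n (Suc m) + 1. u (Suc m, j, k) * node_value L n g e u \<xi> (Suc m) j)"
    proof (rule lipschitz_on_sum)
      fix j
      obtain D where "D-lipschitz_on UNIV (\<lambda>\<xi>. node_value L n g e u \<xi> (Suc m) j)"
        using less.IH[of "Suc m" j] less.prems 3 by auto
      then show "\<exists>D. D-lipschitz_on UNIV (\<lambda>\<xi>. u (Suc m, j, k) * node_value L n g e u \<xi> (Suc m) j)"
        using lipschitz_on_cmult_real by blast
    qed
    then obtain D where "D-lipschitz_on UNIV
        (\<lambda>\<xi>. \<Sum>j = 1..n (Suc m) + 1. u (Suc m, j, k) * node_value L n g e u \<xi> (Suc m) j)" ..
    then have "(C * D)-lipschitz_on UNIV (\<lambda>\<xi>. g l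
        (\<Sum>j = 1..n (Suc m) + 1. u (Suc m, j, k) * node_value L n g e u \<xi> (Suc m) j))"
      by (rule lipschitz_on_compose2) (rule lipschitz_on_subset[OF C], simp)
    then show ?thesis
      unfolding 3 node_value.simps
      by (cases "Suc (Suc m) < L \<and> k = 1")
        (simp_all only: simp_thms if_True if_False, auto intro: lipschitz_on_constant)
  qed
qed

lemma network_map_lipschitz:
  assumes "\<forall>l\<in>{2..L}. \<exists>C. C-lipschitz_on UNIV (g l)"
  shows "\<exists>C. C-lipschitz_on UNIV (network_map L n g e u)"
  by (rule lipschitz_on_vec) (simp add: network_map_def node_value_lipschitz[OF assms])

text \<open>The bound on network maps holds for any weights, so current and frozen ones are treated
  alike; the remaining alternative is constant.\<close>

lemma interaction_lipschitz:
  assumes "\<forall>l\<in>{2..L}. \<exists>C. C-lipschitz_on UNIV (g l)"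
    and "interaction_terms L n g e W" and "u \<in> weight_vectors L n"
  shows "\<exists>C. C-lipschitz_on UNIV (W u i j)"
  using assms(2,3) network_map_lipschitz[OF assms(1)] lipschitz_on_constant
  unfolding interaction_terms_def by metis

section \<open>The agents as one differential equation\<close>

definition agent_field :: "('n \<Rightarrow> 'n \<Rightarrow> real ^ 'd \<Rightarrow> real ^ 'd) \<Rightarrow> real ^ 'd ^ 'n \<Rightarrow> real ^ 'd ^ 'n" where
  "agent_field V x = (\<chi> i. \<Sum>j\<in>UNIV. V i j (x $ j - x $ i))"

text \<open>The difference of two coordinate projections is 2-Lipschitz; composing with
  \<open>V i j\<close> and summing preserves the property.\<close>

lemma agent_field_lipschitz:
  fixes V :: "'n::finite \<Rightarrow> 'n \<Rightarrow> real ^ 'd \<Rightarrow> real ^ 'd"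
  assumes "\<And>i j. \<exists>C. C-lipschitz_on UNIV (V i j)"
  shows "\<exists>C. C-lipschitz_on UNIV (agent_field V)"
proof (rule lipschitz_on_vec)
  fix i
  have "\<exists>D. D-lipschitz_on UNIV (\<lambda>x. V i j (x $ j - x $ i))" for j
  proof -
    obtain C where C: "C-lipschitz_on UNIV (V i j)"
      using assms by blast
    have "(1 + 1)-lipschitz_on UNIV (\<lambda>x :: real ^ 'd ^ 'n. x $ j - x $ i)"
      by (intro lipschitz_on_diff lipschitz_on_vec_nth)
    from lipschitz_on_compose2[OF this lipschitz_on_subset[OF C]] show ?thesis
      by auto
  qed
  then show "\<exists>C. C-lipschitz_on UNIV (\<lambda>x. agent_field V x $ i)"
    by (simp add: agent_field_def lipschitz_on_sum)
qed

text \<open>Links the agentwise system to a single vector equation. The C1 requirement comes for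
  free in one direction, since the derivative is a continuous field along a continuous
  curve.\<close>

lemma agent_solution_iff:
  assumes T: "T > 0" and cont: "continuous_on UNIV (agent_field V)"
  shows "agent_solution T V z0 x \<longleftrightarrow> x 0 = z0 \<and>
    (\<forall>t\<in>{0..T}. (x has_vector_derivative agent_field V (x t)) (at t within {0..T}))"
    (is "_ \<longleftrightarrow> _ \<and> ?ode")
proof (intro iffI conjI)
  assume sol: "agent_solution T V z0 x"
  then show "x 0 = z0" by (simp add: agent_solution_def vec_eq_iff)
  from sol obtain x' where
    x': "\<forall>t\<in>{0..T}. (x has_vector_derivative x' t) (at t within {0..T})"
    unfolding agent_solution_def C1_on_interval_def by blast
  show ?ode
  proof
    fix t assume t: "t \<in> {0..T}"
    \<comment> \<open>Since \<open>T > 0\<close>, derivatives within \<open>{0..T}\<close> are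
      unique even at the end points, which identifies \<open>x'\<close> coordinate by
      coordinate.\<close>
    have "x' t = agent_field V (x t)"
    proof (subst vec_eq_iff, intro allI)
      fix i
      have "((\<lambda>s. x s $ i) has_vector_derivative x' t $ i) (at t within {0..T})"
        using x' t by (auto intro: bounded_linear.has_vector_derivative[OF bounded_linear_vec_nth])
      moreover have "((\<lambda>s. x s $ i) has_vector_derivative agent_field V (x t) $ i) (at t within {0..T})"
        using sol t by (simp add: agent_solution_def agent_field_def)
      ultimately show "x' t $ i = agent_field V (x t) $ i"
        using vector_derivative_unique_within_closed_interval[of 0 T t] T t by simp
    qed
    with bspec[OF x' t] show "(x has_vector_derivative agent_field V (x t)) (at t within {0..T})"
      by simp
  qed
next
  assume x: "x 0 = z0 \<and> ?ode"
  then have "continuous_on {0..T} x"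
    using has_vector_derivative_continuous continuous_on_eq_continuous_within by blast
  then have "continuous_on {0..T} (\<lambda>t. agent_field V (x t))"
    using continuous_on_compose2[OF cont] by blast
  with x have "C1_on_interval T x"
    unfolding C1_on_interval_def by (intro exI[of _ "\<lambda>t. agent_field V (x t)"]) simp
  moreover have "((\<lambda>s. x s $ i) has_vector_derivative (\<Sum>j\<in>UNIV. V i j (x t $ j - x t $ i)))
      (at t within {0..T})" if "t \<in> {0..T}" for i t
    using bounded_linear.has_vector_derivative[OF bounded_linear_vec_nth[of i]] x that
    by (fastforce simp: agent_field_def)
  ultimately show "agent_solution T V z0 x"
    using x by (simp add: agent_solution_def)
qed

theorem theorem1:
  fixes L d :: nat
    and n :: "nat \<Rightarrow> nat"
    and g :: "nat \<Rightarrow> real \<Rightarrow> real"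
    and e :: "nat \<Rightarrow> 'd::finite"
    and W :: "(nat \<times> nat \<times> nat \<Rightarrow> real) \<Rightarrow> 'n::finite \<Rightarrow> 'n \<Rightarrow> real ^ 'd \<Rightarrow> real ^ 'd"
    and T :: real
  assumes "L \<ge> 2"
    and "n 1 = d" and "n L = d"
    and "bij_betw e {1..d} UNIV"
    and "\<forall>l\<in>{2..L}. \<exists>C. C-lipschitz_on UNIV (g l)"
    and "interaction_terms L n g e W"
    and "T > 0"
  shows "\<forall>u\<in>weight_vectors L n. \<forall>z0 :: real ^ 'd ^ 'n.
    \<exists>x. agent_solution T (W u) z0 x \<and>
        (\<forall>y. agent_solution T (W u) z0 y \<longrightarrow> (\<forall>t\<in>{0..T}. y t = x t))"
proof (intro ballI allI)
  fix u and z0 :: "real ^ 'd ^ 'n"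
  assume u: "u \<in> weight_vectors L n"
  obtain C where C: "C-lipschitz_on UNIV (agent_field (W u))"
    using agent_field_lipschitz interaction_lipschitz[OF assms(5,6) u] by blast
  \<comment> \<open>As an equivalence, this transfers existence for \<open>x\<close> and uniqueness
    against every \<open>y\<close> alike.\<close>
  note iff = agent_solution_iff[OF \<open>T > 0\<close> lipschitz_on_continuous_on[OF C]]
  have "T \<ge> 0" using \<open>T > 0\<close> by simp
  from global_picard_lindelof[OF C this, of z0] obtain x where "x 0 = z0"
    and "\<And>t. t \<in> {0..T} \<Longrightarrow> (x has_vector_derivative agent_field (W u) (x t)) (at t within {0..T})"
    and "\<And>y t. \<lbrakk>y 0 = z0;
           \<And>t. t \<in> {0..T} \<Longrightarrow> (y has_vector_derivative agent_field (W u) (y t)) (at t within {0..T});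
           t \<in> {0..T}\<rbrakk> \<Longrightarrow> y t = x t"
    by blast
  then show "\<exists>x. agent_solution T (W u) z0 x \<and>
      (\<forall>y. agent_solution T (W u) z0 y \<longrightarrow> (\<forall>t\<in>{0..T}. y t = x t))"
    unfolding iff by blast
qed

end
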